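(* If $m=q\geq 2$ are even integers, then $(MR^2MRM^2R)^{\frac{m}{2}}$ generates a self-conjugate CMP of $m^{2(m+1)}$.
   Context: Let $m\ge 2$ be an integer. A partition $\lambda$ of a positive integer is $m$-ary if all its parts are powers $m^i$, $i\ge 0$ (so $m^0=1$ is allowed). If $a_i$ is the number of times the part $m^i$ appears in $\lambda$, one writes $\lambda=(a_k,a_{k-1},\ldots,a_0)_m$, where $a_k\neq 0$ and $a_i=0$ for $i>k$. A CMP (conjugate $m$-ary partition, i.e. conjugate $(m,m)$-ary partition) is an $m$-ary partition $\lambda$ whose conjugate $\lambda'$ is also $m$-ary; it is self-conjugate if $\lambda=\lambda'$. On CMPs $\lambda=(a_k,\ldots,a_0)_m$ define the operators (each producing a CMP; here $q=m$): raise $R(\lambda)=(ma_k,\ldots,ma_0)_m$ and migration $M(\lambda)=(1,a_k-1,a_{k-1},\ldots,a_0)_m$. Sequences of operators are composed as functions (rightmost applied first); a sequence $A$ generates the partition $A(1)_m$, where $(1)_m$ is the trivial partition of $1$. *)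

theory Defs
  imports "HOL-Library.Multiset"
begin

(* A partition is represented by the multiset of its parts. *)

definition partition_of :: "nat \<Rightarrow> nat multiset \<Rightarrow> bool" where
  "partition_of n \<mu> \<longleftrightarrow> 0 \<notin># \<mu> \<and> \<Sum>\<^sub># \<mu> = n"

(* The j-th part of the conjugate is the number of parts of \<mu> that are at least j,
   for j = 1, ..., largest part of \<mu>. *)
definition conjugate :: "nat multiset \<Rightarrow> nat multiset" where
  "conjugate \<mu> = {# size {# p \<in># \<mu>. j \<le> p #}. j \<in># mset_set {j. 1 \<le> j \<and> (\<exists>p\<in>#\<mu>. j \<le> p)} #}"

definition self_conjugate :: "nat multiset \<Rightarrow> bool" where
  "self_conjugate \<mu> \<longleftrightarrow> conjugate \<mu> = \<mu>"

definition m_ary :: "nat \<Rightarrow> nat multiset \<Rightarrow> bool" where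
  "m_ary m \<mu> \<longleftrightarrow> (\<exists>n>0. partition_of n \<mu>) \<and> (\<forall>p\<in>#\<mu>. \<exists>i. p = m ^ i)"

definition cmp :: "nat \<Rightarrow> nat multiset \<Rightarrow> bool" where
  "cmp m \<mu> \<longleftrightarrow> m_ary m \<mu> \<and> m_ary m (conjugate \<mu>)"

(* (a_k, ..., a_0)_m, where the list is [a_k, ..., a_0], leading multiplicity first. *)
definition from_mults :: "nat \<Rightarrow> nat list \<Rightarrow> nat multiset" where
  "from_mults m as = (\<Sum>i<length as. replicate_mset (rev as ! i) (m ^ i))"

(* The list [a_k, ..., a_0] of an m-ary partition; k is the largest exponent that occurs. *)
definition mults :: "nat \<Rightarrow> nat multiset \<Rightarrow> nat list" where
  "mults m \<mu> = map (\<lambda>i. count \<mu> (m ^ i)) (rev [0..<Suc (Max {i. m ^ i \<in># \<mu>})])"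

(* R (a_k, ..., a_0)_m = (m a_k, ..., m a_0)_m *)
definition raise :: "nat \<Rightarrow> nat multiset \<Rightarrow> nat multiset" where
  "raise m \<mu> = from_mults m (map (\<lambda>a. m * a) (mults m \<mu>))"

(* M (a_k, ..., a_0)_m = (1, a_k - 1, a_{k-1}, ..., a_0)_m; the subtraction does not truncate,
   since a_k is nonzero for an m-ary partition. *)
definition migration :: "nat \<Rightarrow> nat multiset \<Rightarrow> nat multiset" where
  "migration m \<mu> = (let as = mults m \<mu> in from_mults m (1 # (hd as - 1) # tl as))"

end

theory Submission
  imports Defs
begin

text \<open>
  Draw the Ferrers diagram of an m-ary partition on a logarithmic scale. Every partition generated
  here has a diagram that is a union of rectangles of width \<open>m ^ i\<close> and height \<open>m ^ l\<close>, where
  \<open>(i, l)\<close> ranges over a finite set of corners. Both operators act simply on this picture.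
  Raising repeats every part \<open>m\<close> times, so it moves each corner \<open>(i, l)\<close> to \<open>(i, l + 1)\<close>. Migration
  replaces one largest part \<open>m ^ k\<close> by \<open>m ^ (k + 1)\<close>, so it adds the corner \<open>(k + 1, 0)\<close>.

  Consequently the block \<open>M R\<^sup>2 M R M\<^sup>2 R\<close> sends corners \<open>(i, l)\<close> to \<open>(i, l + 4)\<close> and adds
  \<open>(k + 2, 3)\<close>, \<open>(k + 3, 2)\<close> and \<open>(k + 4, 0)\<close>, while \<open>k\<close> grows by 4. From the trivial partition,
  \<open>j\<close> blocks therefore lead to the corners \<open>(4a, 4b)\<close> with \<open>a + b = j\<close>, and \<open>(4a + 2, 4b + 3)\<close>,
  \<open>(4a + 3, 4b + 2)\<close> with \<open>a + b + 1 = j\<close>. This set is symmetric under exchanging the coordinates, and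
  exchanging the coordinates is conjugation; so the partition is self-conjugate
  (\<open>self_conjugate_if_symmetric_corners\<close>) after every number of blocks.

  The number of blocks matters only for the size. Let \<open>S\<^sub>j\<close> be the sum of the parts after \<open>j\<close>
  blocks. Following it through a block gives
  \<open>S\<^sub>j\<^sub>+\<^sub>1 = m\<^sup>4 S\<^sub>j + 2 m ^ (4 j + 5) - 2 m ^ (4 j + 3)\<close>, hence
  \<open>m S\<^sub>j = m ^ (4 j) (m + 2 j (m\<^sup>2 - 1))\<close>. For \<open>2 j = m\<close> the bracket collapses to \<open>m\<^sup>3\<close>, so that
  \<open>S\<^sub>j = m ^ (2 m + 2)\<close>.
\<close>

section \<open>The operators on multisets of parts\<close>

text \<open>
  Besides being m-ary, the invariant records the exponent of the largest part: migration acts on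
  that part, so its exponent determines the corner that a migration adds.
\<close>
definition ary_with_top :: "nat \<Rightarrow> nat \<Rightarrow> nat multiset \<Rightarrow> bool" where
  "ary_with_top m k \<mu> \<longleftrightarrow> m ^ k \<in># \<mu> \<and> (\<forall>p\<in>#\<mu>. \<exists>i\<le>k. p = m ^ i)"

lemma m_ary_if_ary_with_top:
  assumes "m \<ge> 2" and "ary_with_top m k \<mu>"
  shows "m_ary m \<mu>"
proof -
  have "0 \<notin># \<mu>"
    using assms by (force simp: ary_with_top_def)
  moreover have "\<Sum>\<^sub># \<mu> > 0"
    using assms multi_member_split[of "m ^ k" \<mu>] by (auto simp: ary_with_top_def)
  ultimately show ?thesis
    using assms by (auto simp: m_ary_def partition_of_def ary_with_top_def)
qed

lemma from_mults_Nil: "from_mults m [] = {#}"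
  by (simp add: from_mults_def)

lemma from_mults_Cons:
  "from_mults m (a # as) = from_mults m as + replicate_mset a (m ^ length as)"
  by (simp add: from_mults_def nth_append)

lemma from_mults_map_mult: "from_mults m (map ((*) c) as) = repeat_mset c (from_mults m as)"
  by (induction as) (auto simp: from_mults_Nil from_mults_Cons intro: multiset_eqI)

lemma mults_if_ary_with_top:
  assumes "m \<ge> 2" and "ary_with_top m k \<mu>"
  shows "mults m \<mu> = map (\<lambda>i. count \<mu> (m ^ i)) (rev [0..<Suc k])"
proof -
  have sub: "{i. m ^ i \<in># \<mu>} \<subseteq> {..k}"
    using assms by (force simp: ary_with_top_def)
  have "Max {i. m ^ i \<in># \<mu>} = k"
    using assms sub finite_subset[OF sub] by (intro Max_eqI) (auto simp: ary_with_top_def)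
  then show ?thesis
    by (simp add: mults_def)
qed

lemma from_mults_mults:
  assumes "m \<ge> 2" and "ary_with_top m k \<mu>"
  shows "from_mults m (mults m \<mu>) = \<mu>"
proof (rule multiset_eqI)
  fix x
  have "count (from_mults m (mults m \<mu>)) x
      = (\<Sum>i<Suc k. if x = m ^ i then count \<mu> (m ^ i) else 0)"
    using assms by (simp add: mults_if_ary_with_top from_mults_def rev_map count_sum
        nth_append del: upt_Suc sum.lessThan_Suc cong: if_cong)
  also have "\<dots> = count \<mu> x"
  proof (cases "x \<in># \<mu>")
    case True
    then obtain l where "l < Suc k" "x = m ^ l"
      using assms by (auto simp: ary_with_top_def less_Suc_eq_le)
    with assms show ?thesis
      by (simp del: sum.lessThan_Suc)
  next
    case False
    then show ?thesis
      by (intro trans[OF sum.neutral]) (auto simp: not_in_iff)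
  qed
  finally show "count (from_mults m (mults m \<mu>)) x = count \<mu> x" .
qed

text \<open>
  The list of multiplicities represents the partition faithfully, so each operator can be read
  off as an operation on the multiset of parts.
\<close>
lemma raise_eq_repeat_mset:
  assumes "m \<ge> 2" and "ary_with_top m k \<mu>"
  shows "raise m \<mu> = repeat_mset m \<mu>"
  using assms by (simp add: raise_def from_mults_map_mult from_mults_mults)

lemma migration_eq_replace_top:
  assumes "m \<ge> 2" and "ary_with_top m k \<mu>"
  shows "migration m \<mu> = add_mset (m ^ Suc k) (\<mu> - {#m ^ k#})"
proof -
  obtain c as where as: "mults m \<mu> = Suc c # as" "length as = k"
  proof -
    have "count \<mu> (m ^ k) > 0"
      using assms by (simp add: ary_with_top_def)
    then obtain c where "count \<mu> (m ^ k) = Suc c"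
      by (auto simp only: gr0_conv_Suc)
    with assms have "mults m \<mu> = Suc c # map (\<lambda>i. count \<mu> (m ^ i)) (rev [0..<k])"
      by (simp add: mults_if_ary_with_top)
    with that show thesis
      by simp
  qed
  have "\<mu> = from_mults m as + replicate_mset (Suc c) (m ^ k)"
    using from_mults_mults[OF assms] as by (simp add: from_mults_Cons)
  moreover have "migration m \<mu>
      = add_mset (m ^ Suc k) (from_mults m as + replicate_mset c (m ^ k))"
    using as by (simp add: migration_def from_mults_Cons)
  ultimately show ?thesis
    by (metis add_mset_remove_trivial replicate_mset_Suc union_mset_add_mset_right)
qed

lemma ary_with_top_raise:
  assumes "m \<ge> 2" and "ary_with_top m k \<mu>"
  shows "ary_with_top m k (raise m \<mu>)"
  using assms by (simp add: raise_eq_repeat_mset)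
    (simp add: ary_with_top_def flip: count_greater_zero_iff)

lemma ary_with_top_migration:
  assumes "m \<ge> 2" and "ary_with_top m k \<mu>"
  shows "ary_with_top m (Suc k) (migration m \<mu>)"
  using assms
  by (simp add: migration_eq_replace_top)
    (force simp: ary_with_top_def intro: le_SucI dest: in_diffD)

lemma sum_raise:
  assumes "m \<ge> 2" and "ary_with_top m k \<mu>"
  shows "\<Sum>\<^sub># (raise m \<mu>) = m * \<Sum>\<^sub># \<mu>"
proof -
  have "\<Sum>\<^sub># (repeat_mset c \<mu>) = c * \<Sum>\<^sub># \<mu>" for c
    by (induction c) auto
  with assms show ?thesis
    by (simp add: raise_eq_repeat_mset)
qed

lemma sum_migration:
  assumes "m \<ge> 2" and "ary_with_top m k \<mu>"
  shows "\<Sum>\<^sub># (migration m \<mu>) + m ^ k = \<Sum>\<^sub># \<mu> + m ^ Suc k"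
proof -
  obtain \<nu> where "\<mu> = add_mset (m ^ k) \<nu>"
    using assms by (auto simp: ary_with_top_def dest: multi_member_split)
  with assms show ?thesis
    by (simp add: migration_eq_replace_top)
qed

section \<open>Ferrers diagrams described by corners\<close>

abbreviation parts_ge :: "nat multiset \<Rightarrow> nat \<Rightarrow> nat" where
  "parts_ge \<mu> t \<equiv> size {#p \<in># \<mu>. t \<le> p#}"

text \<open>
  The cell in row \<open>s\<close> and column \<open>t\<close> lies in the diagram iff at least \<open>s\<close> parts are \<open>\<ge> t\<close>. Corners
  that are dominated by another corner are allowed, so the set \<open>C\<close> is not determined by \<open>\<mu>\<close>; this
  freedom makes it possible to forget the corners that would spoil symmetry.
\<close>
definition has_corners :: "nat \<Rightarrow> (nat \<times> nat) set \<Rightarrow> nat multiset \<Rightarrow> bool" where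
  "has_corners m C \<mu> \<longleftrightarrow>
    (\<forall>s\<ge>1. \<forall>t\<ge>1. s \<le> parts_ge \<mu> t \<longleftrightarrow> (\<exists>(i, l)\<in>C. t \<le> m ^ i \<and> s \<le> m ^ l))"

lemma finite_columns: "finite {j. 1 \<le> j \<and> (\<exists>p\<in>#\<mu>. j \<le> p)}" for \<mu> :: "nat multiset"
  by (rule finite_subset[of _ "\<Union>p\<in>set_mset \<mu>. {..p}"]) auto

lemma parts_ge_conjugate:
  assumes "t \<ge> 1"
  shows "parts_ge (conjugate \<mu>) t = card {j. 1 \<le> j \<and> t \<le> parts_ge \<mu> j}"
proof -
  have "\<exists>p\<in>#\<mu>. j \<le> p" if "t \<le> parts_ge \<mu> j" for j
  proof -
    have "{#p \<in># \<mu>. j \<le> p#} \<noteq> {#}"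
      using that assms by (auto simp del: filter_mset_eq_mempty_iff)
    then show ?thesis
      by auto
  qed
  then have "{j. (1 \<le> j \<and> (\<exists>p\<in>#\<mu>. j \<le> p)) \<and> t \<le> parts_ge \<mu> j} = {j. 1 \<le> j \<and> t \<le> parts_ge \<mu> j}"
    by blast
  then show ?thesis
    by (simp add: conjugate_def filter_mset_image_mset finite_columns)
qed

lemma zero_notin_conjugate: "0 \<notin># conjugate \<mu>"
  by (auto simp: conjugate_def finite_columns)

lemma multiset_eq_if_parts_ge_eq:
  assumes "0 \<notin># \<mu>" "0 \<notin># \<nu>" and eq: "\<And>t. t \<ge> 1 \<Longrightarrow> parts_ge \<mu> t = parts_ge \<nu> t"
  shows "\<mu> = \<nu>"
proof (rule multiset_eqI)
  fix x
  have split: "parts_ge \<kappa> x = count \<kappa> x + parts_ge \<kappa> (Suc x)" for \<kappa>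
    by (induction \<kappa>) auto
  show "count \<mu> x = count \<nu> x"
  proof (cases "x = 0")
    case True
    then show ?thesis
      using assms by (simp add: not_in_iff)
  next
    case False
    then show ?thesis
      using split[of \<mu>] split[of \<nu>] eq[of x] eq[of "Suc x"] by simp
  qed
qed

text \<open>
  By symmetry of the diagram the columns \<open>j\<close> of height at least \<open>t\<close> are those with
  \<open>j \<le> parts_ge \<mu> t\<close>, and there are exactly \<open>parts_ge \<mu> t\<close> of them.
\<close>
lemma self_conjugate_if_symmetric_corners:
  assumes "0 \<notin># \<mu>" and C: "has_corners m C \<mu>" and sym: "\<And>i l. (i, l) \<in> C \<Longrightarrow> (l, i) \<in> C"
  shows "self_conjugate \<mu>"
  unfolding self_conjugate_def
proof (rule multiset_eq_if_parts_ge_eq[OF zero_notin_conjugate assms(1)])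
  fix t :: nat
  assume t: "t \<ge> 1"
  have "t \<le> parts_ge \<mu> j \<longleftrightarrow> j \<le> parts_ge \<mu> t" if "j \<ge> 1" for j
    using C sym t that by (fastforce simp: has_corners_def)
  then have "{j. 1 \<le> j \<and> t \<le> parts_ge \<mu> j} = {1..parts_ge \<mu> t}"
    by auto
  then show "parts_ge (conjugate \<mu>) t = parts_ge \<mu> t"
    using t by (simp add: parts_ge_conjugate)
qed

text \<open>
  If \<open>s\<close> parts out of \<open>m * parts_ge \<mu> t\<close> are required, the corner that provides all the
  \<open>parts_ge \<mu> t\<close> original parts also works after it has been lifted.
\<close>
lemma has_corners_raise:
  assumes m: "m \<ge> 2" and top: "ary_with_top m k \<mu>" and C: "has_corners m C \<mu>"
  shows "has_corners m (map_prod id Suc ` C) (raise m \<mu>)"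
  unfolding has_corners_def
proof (intro allI impI)
  fix s t :: nat
  assume s: "s \<ge> 1" and t: "t \<ge> 1"
  have eq: "parts_ge (raise m \<mu>) t = m * parts_ge \<mu> t"
  proof -
    have "{#p \<in># repeat_mset m \<mu>. t \<le> p#} = repeat_mset m {#p \<in># \<mu>. t \<le> p#}"
      by (rule multiset_eqI) simp
    with m top show ?thesis
      by (simp add: raise_eq_repeat_mset)
  qed
  show "s \<le> parts_ge (raise m \<mu>) t \<longleftrightarrow>
    (\<exists>(i, l)\<in>map_prod id Suc ` C. t \<le> m ^ i \<and> s \<le> m ^ l)" (is "_ \<longleftrightarrow> ?R")
  proof
    assume "s \<le> parts_ge (raise m \<mu>) t"
    then have le: "s \<le> m * parts_ge \<mu> t"
      by (simp add: eq)
    with s have "parts_ge \<mu> t \<ge> 1"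
      by (cases "parts_ge \<mu> t") auto
    then obtain i l where il: "(i, l) \<in> C" "t \<le> m ^ i" "parts_ge \<mu> t \<le> m ^ l"
      using C t unfolding has_corners_def by blast
    have "s \<le> m ^ Suc l"
      using le_trans[OF le mult_le_mono2[OF il(3)]] by simp
    with il show ?R
      by force
  next
    assume ?R
    then obtain i l where il: "(i, l) \<in> C" "t \<le> m ^ i" "s \<le> m ^ Suc l"
      by auto
    have "m ^ l \<ge> 1"
      using m by simp
    then have "m ^ l \<le> parts_ge \<mu> t"
      using C t il unfolding has_corners_def by blast
    then have "m ^ Suc l \<le> m * parts_ge \<mu> t"
      by simp
    with il show "s \<le> parts_ge (raise m \<mu>) t"
      unfolding eq by (blast intro: le_trans)
  qed
qed

text \<open>
  Migration keeps all columns \<open>t \<le> m ^ k\<close>, because the replaced part stays at least \<open>t\<close>, and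
  gives the previously empty columns up to \<open>m ^ (k + 1)\<close> a single cell in the first row. The rectangle
  added by the corner \<open>(k + 1, 0)\<close> is exactly this first row.
\<close>
lemma has_corners_migration:
  assumes m: "m \<ge> 2" and top: "ary_with_top m k \<mu>" and C: "has_corners m C \<mu>"
  shows "has_corners m (insert (Suc k, 0) C) (migration m \<mu>)"
proof -
  obtain \<nu> where \<nu>: "\<mu> = add_mset (m ^ k) \<nu>"
    using top by (auto simp: ary_with_top_def dest: multi_member_split)
  have M: "migration m \<mu> = add_mset (m ^ Suc k) \<nu>"
    using migration_eq_replace_top[OF m top] by (simp add: \<nu>)
  have ge: "parts_ge \<mu> t = parts_ge \<nu> t + (if t \<le> m ^ k then 1 else 0)"
    "parts_ge (migration m \<mu>) t = parts_ge \<nu> t + (if t \<le> m ^ Suc k then 1 else 0)" for t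
    unfolding M by (simp_all add: \<nu>)
  have lt: "m ^ k < m ^ Suc k"
    using m by simp
  have le: "p \<le> m ^ k" if "p \<in># \<nu>" for p
    using top that m by (auto simp: \<nu> ary_with_top_def power_increasing)
  have "s \<le> parts_ge (migration m \<mu>) t \<longleftrightarrow> s \<le> parts_ge \<mu> t \<or> (t \<le> m ^ Suc k \<and> s \<le> 1)"
    if "s \<ge> 1" for s t
  proof (cases "t \<le> m ^ k")
    case True
    with lt that show ?thesis
      by (auto simp: ge simp del: power_Suc)
  next
    case False
    then have none: "parts_ge \<nu> t = 0"
      using le by force
    show ?thesis
      unfolding ge none using False that by auto
  qed
  with C show ?thesis
    by (auto simp: has_corners_def simp del: power_Suc)
qed

lemma has_corners_remove_dominated:
  assumes "m \<ge> 2" and C: "has_corners m (insert (i, l) C) \<mu>"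
    and dom: "(i', l') \<in> C" "i \<le> i'" "l \<le> l'"
  shows "has_corners m C \<mu>"
proof -
  have "m ^ i \<le> m ^ i'" "m ^ l \<le> m ^ l'"
    using assms by (auto intro: power_increasing)
  then have "(\<exists>(a, b)\<in>insert (i, l) C. t \<le> m ^ a \<and> s \<le> m ^ b) \<longleftrightarrow>
      (\<exists>(a, b)\<in>C. t \<le> m ^ a \<and> s \<le> m ^ b)" for s t
    using dom(1) by (auto intro: le_trans)
  with C show ?thesis
    by (simp add: has_corners_def)
qed

section \<open>Iterating the block of operators\<close>

abbreviation block :: "nat \<Rightarrow> nat multiset \<Rightarrow> nat multiset" where
  "block m \<equiv> migration m \<circ> raise m ^^ 2 \<circ> migration m \<circ> raise m \<circ> migration m ^^ 2 \<circ> raise m"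

text \<open>
  The new corner \<open>(k + 2, 3)\<close> comes from the second of the two consecutive migrations, lifted by the
  three later raises; \<open>(k + 3, 2)\<close> from the next migration, lifted by two; and \<open>(k + 4, 0)\<close> from the
  last one. In the sum, the four migrations contribute differences of consecutive powers,
  multiplied by \<open>m\<close> for each later raise; all but \<open>2 * m ^ (k + 5) - 2 * m ^ (k + 3)\<close> cancels.
\<close>
lemma block_effect:
  assumes m: "m \<ge> 2" and top: "ary_with_top m k \<mu>" and C: "has_corners m C \<mu>"
  shows "ary_with_top m (k + 4) (block m \<mu>)"
    and "has_corners m
      ({(k + 4, 0), (k + 3, 2), (k + 2, 3)} \<union> map_prod id ((+) 4) ` C) (block m \<mu>)"
    and "\<Sum>\<^sub># (block m \<mu>) + 2 * m ^ (k + 3) = m ^ 4 * \<Sum>\<^sub># \<mu> + 2 * m ^ (k + 5)"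
proof -
  note tops = ary_with_top_raise[OF m] ary_with_top_migration[OF m]
  define \<mu>1 where "\<mu>1 = raise m \<mu>"
  define \<mu>2 where "\<mu>2 = migration m \<mu>1"
  define \<mu>3 where "\<mu>3 = migration m \<mu>2"
  define \<mu>4 where "\<mu>4 = raise m \<mu>3"
  define \<mu>5 where "\<mu>5 = migration m \<mu>4"
  define \<mu>6 where "\<mu>6 = raise m \<mu>5"
  define \<mu>7 where "\<mu>7 = raise m \<mu>6"
  have block: "block m \<mu> = migration m \<mu>7"
    by (simp add: \<mu>1_def \<mu>2_def \<mu>3_def \<mu>4_def \<mu>5_def \<mu>6_def \<mu>7_def numeral_2_eq_2)
  have t1: "ary_with_top m k \<mu>1"
    unfolding \<mu>1_def by (intro tops top)
  have t2: "ary_with_top m (Suc k) \<mu>2"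
    unfolding \<mu>2_def by (intro tops t1)
  have t3: "ary_with_top m (Suc (Suc k)) \<mu>3"
    unfolding \<mu>3_def by (intro tops t2)
  have t4: "ary_with_top m (Suc (Suc k)) \<mu>4"
    unfolding \<mu>4_def by (intro tops t3)
  have t5: "ary_with_top m (Suc (Suc (Suc k))) \<mu>5"
    unfolding \<mu>5_def by (intro tops t4)
  have t6: "ary_with_top m (Suc (Suc (Suc k))) \<mu>6"
    unfolding \<mu>6_def by (intro tops t5)
  have t7: "ary_with_top m (Suc (Suc (Suc k))) \<mu>7"
    unfolding \<mu>7_def by (intro tops t6)
  show "ary_with_top m (k + 4) (block m \<mu>)"
    unfolding block using tops(2)[OF t7] by (simp add: eval_nat_numeral)

  let ?C1 = "map_prod id Suc ` C"
  have "has_corners m (insert (Suc k, 0) ?C1) \<mu>2"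
    unfolding \<mu>1_def \<mu>2_def
    by (rule has_corners_migration[OF m t1[unfolded \<mu>1_def] has_corners_raise[OF m top C]])
  then have "has_corners m (insert (Suc (Suc k), 0) (insert (Suc k, 0) ?C1)) \<mu>3"
    unfolding \<mu>3_def by (rule has_corners_migration[OF m t2])
  \<comment> \<open>The corner left by the first of two consecutive migrations has no mirror image
    in the final set, but the second migration dominates it.\<close>
  then have "has_corners m (insert (Suc k, 0) (insert (Suc (Suc k), 0) ?C1)) \<mu>3"
    by (simp only: insert_commute)
  then have "has_corners m (insert (Suc (Suc k), 0) ?C1) \<mu>3"
    by (rule has_corners_remove_dominated[OF m, where i' = "Suc (Suc k)" and l' = 0]) auto
  then have "has_corners m (map_prod id Suc ` insert (Suc (Suc k), 0) ?C1) \<mu>4"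
    unfolding \<mu>4_def by (rule has_corners_raise[OF m t3])
  then have "has_corners m (insert (Suc (Suc (Suc k)), 0)
      (map_prod id Suc ` insert (Suc (Suc k), 0) ?C1)) \<mu>5"
    unfolding \<mu>5_def by (rule has_corners_migration[OF m t4])
  then have "has_corners m (map_prod id Suc ` map_prod id Suc ` insert (Suc (Suc (Suc k)), 0)
      (map_prod id Suc ` insert (Suc (Suc k), 0) ?C1)) \<mu>7"
    unfolding \<mu>6_def \<mu>7_def
    by (rule has_corners_raise[OF m t6[unfolded \<mu>6_def] has_corners_raise[OF m t5]])
  then have "has_corners m (insert (Suc (Suc (Suc (Suc k))), 0)
      (map_prod id Suc ` map_prod id Suc ` insert (Suc (Suc (Suc k)), 0)
      (map_prod id Suc ` insert (Suc (Suc k), 0) ?C1))) (block m \<mu>)"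
    unfolding block by (rule has_corners_migration[OF m t7])
  also have "insert (Suc (Suc (Suc (Suc k))), 0)
      (map_prod id Suc ` map_prod id Suc ` insert (Suc (Suc (Suc k)), 0)
      (map_prod id Suc ` insert (Suc (Suc k), 0) ?C1))
    = {(k + 4, 0), (k + 3, 2), (k + 2, 3)} \<union> map_prod id ((+) 4) ` C"
    by (simp add: image_image eval_nat_numeral map_prod_def case_prod_unfold)
  finally show "has_corners m
      ({(k + 4, 0), (k + 3, 2), (k + 2, 3)} \<union> map_prod id ((+) 4) ` C) (block m \<mu>)" .

  have "\<Sum>\<^sub># \<mu>3 + m ^ k = m * \<Sum>\<^sub># \<mu> + m ^ (k + 2)"
    using sum_migration[OF m t2] sum_migration[OF m t1] sum_raise[OF m top]
    by (simp add: \<mu>1_def \<mu>2_def \<mu>3_def)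
  then have "m ^ 3 * (\<Sum>\<^sub># \<mu>3 + m ^ k) = m ^ 3 * (m * \<Sum>\<^sub># \<mu> + m ^ (k + 2))"
    by simp
  then have 3: "m ^ 3 * \<Sum>\<^sub># \<mu>3 + m ^ (k + 3) = m ^ 4 * \<Sum>\<^sub># \<mu> + m ^ (k + 5)"
    by (simp add: algebra_simps power_add eval_nat_numeral)
  have "\<Sum>\<^sub># \<mu>5 + m ^ (k + 2) = m * \<Sum>\<^sub># \<mu>3 + m ^ (k + 3)"
    using sum_migration[OF m t4] sum_raise[OF m t3]
    by (simp add: \<mu>4_def \<mu>5_def eval_nat_numeral)
  then have "m ^ 2 * (\<Sum>\<^sub># \<mu>5 + m ^ (k + 2)) = m ^ 2 * (m * \<Sum>\<^sub># \<mu>3 + m ^ (k + 3))"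
    by simp
  then have 5: "m ^ 2 * \<Sum>\<^sub># \<mu>5 + m ^ (k + 4) = m ^ 3 * \<Sum>\<^sub># \<mu>3 + m ^ (k + 5)"
    by (simp add: algebra_simps power_add eval_nat_numeral)
  have 8: "\<Sum>\<^sub># (block m \<mu>) + m ^ (k + 3) = m ^ 2 * \<Sum>\<^sub># \<mu>5 + m ^ (k + 4)"
    using sum_migration[OF m t7] sum_raise[OF m t6] sum_raise[OF m t5]
    unfolding block
    by (simp add: \<mu>6_def \<mu>7_def eval_nat_numeral ac_simps)
  from 3 5 8 show "\<Sum>\<^sub># (block m \<mu>) + 2 * m ^ (k + 3) = m ^ 4 * \<Sum>\<^sub># \<mu> + 2 * m ^ (k + 5)"
    by linarith
qed

text \<open>
  The corners of the partition after \<open>j\<close> blocks; here \<open>a\<close> is the number of blocks done before the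
  corner appeared and \<open>b\<close> the number of blocks that have lifted it since (for \<open>(4 * a, 4 * b)\<close>,
  the block that creates the corner counts among the \<open>a\<close>).
\<close>
definition corners :: "nat \<Rightarrow> (nat \<times> nat) set" where
  "corners j = {(4 * a, 4 * b) |a b. a + b = j}
    \<union> {(4 * a + 2, 4 * b + 3) |a b. a + b + 1 = j}
    \<union> {(4 * a + 3, 4 * b + 2) |a b. a + b + 1 = j}"

lemma corners_symmetric: "(i, l) \<in> corners j \<Longrightarrow> (l, i) \<in> corners j"
  by (auto simp: corners_def add.commute)

text \<open>
  On an antidiagonal exactly one point has \<open>b = 0\<close>: this is the corner that the latest block has
  just created, whereas the points with \<open>b > 0\<close> are the older corners, lifted once more.
\<close>
lemma antidiagonal_eq_insert_shifted:
  fixes f g :: "nat \<Rightarrow> nat"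
  shows "{(f a, g b) |a b. a + b = j} = insert (f j, g 0) {(f a, g (Suc b)) |a b. a + b + 1 = j}"
proof -
  have "a + b = j \<longleftrightarrow> (a = j \<and> b = 0) \<or> (\<exists>c. b = Suc c \<and> a + c + 1 = j)" for a b
    by (cases b) auto
  then show ?thesis
    by auto
qed

lemma corners_Suc:
  "corners (Suc j) =
    {(4 * j + 4, 0), (4 * j + 3, 2), (4 * j + 2, 3)} \<union> map_prod id ((+) 4) ` corners j"
proof -
  have image: "map_prod id ((+) 4) ` {(f a, g b) |a b. P a b} = {(f a, 4 + g b) |a b. P a b}"
    for f g :: "nat \<Rightarrow> nat" and P
    by force
  show ?thesis
    unfolding corners_def image_Un image
    using antidiagonal_eq_insert_shifted[of "\<lambda>a. 4 * a" "\<lambda>b. 4 * b" "Suc j"]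
      antidiagonal_eq_insert_shifted[of "\<lambda>a. 4 * a + 2" "\<lambda>b. 4 * b + 3" j]
      antidiagonal_eq_insert_shifted[of "\<lambda>a. 4 * a + 3" "\<lambda>b. 4 * b + 2" j]
    by (simp add: ac_simps insert_commute numeral_eq_Suc)
qed

lemma iterated_block:
  assumes m: "m \<ge> 2"
  defines "\<mu> \<equiv> \<lambda>j. (block m ^^ j) {#1#}"
  shows "ary_with_top m (4 * j) (\<mu> j)"
    and "has_corners m (corners j) (\<mu> j)"
    and "m * \<Sum>\<^sub># (\<mu> j) + 2 * j * m ^ (4 * j) = m ^ (4 * j) * (m + 2 * j * m ^ 2)"
proof (induction j)
  case 0
  {
    case 1
    show ?case by (simp add: \<mu>_def ary_with_top_def)
  next
    case 2
    show ?case by (auto simp: \<mu>_def has_corners_def corners_def)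
  next
    case 3
    show ?case by (simp add: \<mu>_def)
  }
next
  case (Suc j)
  note block = block_effect[OF m Suc(1,2)]
  have step: "\<mu> (Suc j) = block m (\<mu> j)"
    by (simp add: \<mu>_def)
  {
    case 1
    show ?case using block(1) by (simp add: step add.commute)
  next
    case 2
    show ?case using block(2) by (simp add: step corners_Suc)
  next
    case 3
    have pow: "m ^ (4 * Suc j) = m ^ (4 * j) * m ^ 4" "m ^ (4 * j + 6) = m ^ (4 * j) * m ^ 4 * m ^ 2"
      "m * m ^ (4 * j + 3) = m ^ (4 * j) * m ^ 4" "m * m ^ (4 * j + 5) = m ^ (4 * j) * m ^ 4 * m ^ 2"
      by (simp_all add: ac_simps flip: power_add power_Suc)
    have "m * (\<Sum>\<^sub># (\<mu> (Suc j)) + 2 * m ^ (4 * j + 3)) + m ^ 4 * (2 * j * m ^ (4 * j))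
        = m ^ 4 * (m * \<Sum>\<^sub># (\<mu> j) + 2 * j * m ^ (4 * j)) + 2 * m ^ (4 * j + 6)"
      unfolding step block(3) pow(2) by (simp add: distrib_left mult.left_commute[of m] pow)
    also have "\<dots> = m ^ 4 * (m ^ (4 * j) * (m + 2 * j * m ^ 2)) + 2 * m ^ (4 * j + 6)"
      unfolding Suc(3) ..
    finally show ?case
      unfolding pow(1,2)
      by (simp add: distrib_left mult.left_commute[of m "2"] pow) (simp add: algebra_simps)
  }
qed

theorem corollary5p5:
  fixes m :: nat
  assumes "m \<ge> 2" and "even m"
  defines "R \<equiv> raise m" and "M \<equiv> migration m"
  defines "\<mu> \<equiv> ((M \<circ> R ^^ 2 \<circ> M \<circ> R \<circ> M ^^ 2 \<circ> R) ^^ (m div 2)) (from_mults m [1])"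
  shows "cmp m \<mu> \<and> self_conjugate \<mu> \<and> partition_of (m ^ (2 * (m + 1))) \<mu>"
proof -
  have \<mu>: "\<mu> = (block m ^^ (m div 2)) {#1#}"
    by (simp add: \<mu>_def R_def M_def from_mults_def)
  have m2: "2 * (m div 2) = m" "4 * (m div 2) = 2 * m"
    using \<open>even m\<close> by auto
  note it = iterated_block[OF \<open>m \<ge> 2\<close>, of "m div 2", folded \<mu>, unfolded m2]
  have ary: "m_ary m \<mu>"
    using m_ary_if_ary_with_top[OF \<open>m \<ge> 2\<close> it(1)] .
  then have zero: "0 \<notin># \<mu>"
    by (auto simp: m_ary_def partition_of_def)
  have self: "self_conjugate \<mu>"
    using self_conjugate_if_symmetric_corners[OF zero it(2) corners_symmetric] .
  have "m ^ (2 * (m + 1)) = m ^ (2 * m) * m ^ 2"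
    by (simp flip: power_add)
  then have "m * \<Sum>\<^sub># \<mu> = m * m ^ (2 * (m + 1))"
    using it(3) by (simp add: algebra_simps power2_eq_square)
  then have "\<Sum>\<^sub># \<mu> = m ^ (2 * (m + 1))"
    using \<open>m \<ge> 2\<close> by simp
  with ary self zero show ?thesis
    by (simp add: cmp_def self_conjugate_def partition_of_def)
qed

end
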